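(* Let $d$ be prime, $n\ge1$, and $\rho$ an $n$-qudit state. Then $\vec\lambda_{\mathcal M(\rho)}\prec\vec\lambda_\rho$, where $\vec\lambda_\tau\in\mathbb R^{d^n}$ denotes the vector of eigenvalues of $\tau$ (with multiplicity). Consequently, for every Schur-concave function $f$ of the spectrum, $f(\rho)\le f(\mathcal M(\rho))$.
   Context: Fix a prime $d$ and $n\ge1$; $\mathcal H=\mathbb C^d$, $\chi(k)=e^{2\pi ik/d}$, $X|k\rangle=|k+1\rangle$, $Z|k\rangle=\chi(k)|k\rangle$. Weyl operators: $w(p,q)=\chi(-2^{-1}pq)Z^pX^q$ for odd $d$, $w(p,q)=i^{-pq}Z^pX^q$ for $d=2$, and $w(\vec p,\vec q)=\bigotimes_k w(p_k,q_k)$ for $(\vec p,\vec q)\in V^n=\mathbb Z_d^n\times\mathbb Z_d^n$. Characteristic function: $\Xi_\rho(\vec p,\vec q)=\mathrm{Tr}[\rho\,w(-\vec p,-\vec q)]$. The mean state $\mathcal M(\rho)$ is the operator with $\Xi_{\mathcal M(\rho)}(\vec x)=\Xi_\rho(\vec x)$ if $|\Xi_\rho(\vec x)|=1$ and $0$ otherwise. For probability vectors $\vec p,\vec q\in\mathbb R^m$, $\vec p\prec\vec q$ means $\sum_{i\le k}p_i^\downarrow\le\sum_{i\le k}q_i^\downarrow$ for all $k$, where $\downarrow$ denotes decreasing rearrangement. $f$ is Schur concave if $\vec p\prec\vec q$ implies $f(\vec p)\ge f(\vec q)$; for a state, $f(\rho):=f(\vec\lambda_\rho)$. *)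

theory Defs
  imports "Jordan_Normal_Form.Jordan_Normal_Form" "HOL-Computational_Algebra.Primes"
begin

definition chi :: "nat \<Rightarrow> int \<Rightarrow> complex" where
  "chi d x = exp (2 * of_real pi * \<i> * of_int x / of_nat d)"

(* phase factor of the single-qudit Weyl operator w(p,q), for p,q in {0..d-1}:
   d = 2: i^(-pq);  d odd: chi(-2^{-1} p q), with 2^{-1} = (d+1)/2 mod d *)
definition weyl_phase :: "nat \<Rightarrow> int \<Rightarrow> int \<Rightarrow> complex" where
  "weyl_phase d p q =
     (if d = 2 then (- \<i>) ^ nat (p * q)
      else chi d (- ((int d + 1) div 2) * p * q))"

(* matrix entry <j| w(p,q) |k> of the single-qudit Weyl operator,
   w(p,q) = phase * Z^p X^q, with Z^p X^q |k> = chi(p (k+q)) |k+q> *)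
definition weyl1 :: "nat \<Rightarrow> int \<Rightarrow> int \<Rightarrow> nat \<Rightarrow> nat \<Rightarrow> complex" where
  "weyl1 d p q j k =
     (if int j mod int d = (int k + q) mod int d
      then weyl_phase d (p mod int d) (q mod int d) * chi d (p * int j) else 0)"

(* k-th digit (base d) of the computational basis index i of (C^d)^{\<otimes> n} *)
definition digit :: "nat \<Rightarrow> nat \<Rightarrow> nat \<Rightarrow> nat" where
  "digit d i k = (i div d ^ k) mod d"

(* n-qudit Weyl operator w(p,q) = tensor_k w(p_k,q_k), as a d^n x d^n matrix;
   p, q : nat => int represent vectors in Z_d^n (only entries k < n matter, mod d) *)
definition weyl :: "nat \<Rightarrow> nat \<Rightarrow> (nat \<Rightarrow> int) \<Rightarrow> (nat \<Rightarrow> int) \<Rightarrow> complex mat" where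
  "weyl d n p q = mat (d ^ n) (d ^ n)
     (\<lambda>(a, b). \<Prod>k<n. weyl1 d (p k) (q k) (digit d a k) (digit d b k))"

definition mtrace :: "complex mat \<Rightarrow> complex" where
  "mtrace A = (\<Sum>i<dim_row A. A $$ (i, i))"

definition char_fun :: "nat \<Rightarrow> nat \<Rightarrow> complex mat \<Rightarrow> (nat \<Rightarrow> int) \<Rightarrow> (nat \<Rightarrow> int) \<Rightarrow> complex" where
  "char_fun d n \<rho> p q = mtrace (\<rho> * weyl d n (\<lambda>k. - p k) (\<lambda>k. - q k))"

definition mean_state :: "nat \<Rightarrow> nat \<Rightarrow> complex mat \<Rightarrow> complex mat" where
  "mean_state d n \<rho> = (THE M. M \<in> carrier_mat (d ^ n) (d ^ n) \<and>
     (\<forall>p q. char_fun d n M p q =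
        (if cmod (char_fun d n \<rho> p q) = 1 then char_fun d n \<rho> p q else 0)))"

definition is_state :: "nat \<Rightarrow> nat \<Rightarrow> complex mat \<Rightarrow> bool" where
  "is_state d n \<rho> \<longleftrightarrow> \<rho> \<in> carrier_mat (d ^ n) (d ^ n) \<and>
     (\<forall>i < d ^ n. \<forall>j < d ^ n. \<rho> $$ (i, j) = cnj (\<rho> $$ (j, i))) \<and>
     (\<forall>v :: nat \<Rightarrow> complex.
        let s = (\<Sum>i < d ^ n. \<Sum>j < d ^ n. cnj (v i) * \<rho> $$ (i, j) * v j)
        in Im s = 0 \<and> Re s \<ge> 0) \<and>
     mtrace \<rho> = 1"

definition spec_vec :: "complex mat \<Rightarrow> real list" where
  "spec_vec A = rev (sorted_list_of_multiset (image_mset Re (proots (char_poly A))))"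

definition prob_vec :: "real list \<Rightarrow> bool" where
  "prob_vec p \<longleftrightarrow> (\<forall>x \<in> set p. 0 \<le> x) \<and> sum_list p = 1"

definition decr :: "real list \<Rightarrow> real list" where
  "decr p = rev (sort p)"

definition majorized :: "real list \<Rightarrow> real list \<Rightarrow> bool" where
  "majorized p q \<longleftrightarrow> length p = length q \<and> prob_vec p \<and> prob_vec q \<and>
     (\<forall>k \<le> length p. sum_list (take k (decr p)) \<le> sum_list (take k (decr q)))"

definition schur_concave :: "nat \<Rightarrow> (real list \<Rightarrow> real) \<Rightarrow> bool" where
  "schur_concave m f \<longleftrightarrow>
     (\<forall>p q. length p = m \<longrightarrow> length q = m \<longrightarrow> majorized p q \<longrightarrow> f q \<le> f p)"

end

theory Submission
  imports Defs "Jordan_Normal_Form.Schur_Decomposition" "HOL-Number_Theory.Cong"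
begin

text \<open>
  Write \<open>N = d\<^sup>n\<close>, \<open>g x = Tr (\<rho> w(x))\<close> and \<open>S = {x. |g x| = 1}\<close>. For \<open>x \<in> S\<close> the equality case of
  the Cauchy--Schwarz inequality gives \<open>\<rho> w(x) = g x \<cdot> \<rho>\<close>. The mean state is
  \<open>M = N\<^sup>-\<^sup>1 \<Sum>x\<in>S. g x \<cdot> w(x)\<^sup>\<dagger>\<close>, so \<open>\<rho> M = c \<rho>\<close> with \<open>c = |S| / N\<close>; and since the Weyl operators
  multiply up to phases, \<open>M w(x) = g x \<cdot> M\<close> on \<open>S\<close> and \<open>M M = c M\<close>. Hence \<open>M\<close> has eigenvalue
  \<open>c = 1/r\<close> with multiplicity \<open>r\<close> and \<open>0\<close> otherwise, while \<open>\<rho> M = c \<rho>\<close> leaves \<open>\<rho>\<close> with at most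
  \<open>r\<close> nonzero eigenvalues. A flat probability vector of length \<open>r\<close> is majorized by every
  probability vector with at most \<open>r\<close> nonzero entries.
\<close>

section \<open>Majorization of flat vectors\<close>

lemma majorized_mset_cong:
  assumes "mset p = mset p'" "mset q = mset q'"
  shows "majorized p q \<longleftrightarrow> majorized p' q'"
proof -
  have "sort p = sort p'" "sort q = sort q'"
    using assms by (auto intro!: properties_for_sort)
  moreover have "length p = length p'" "length q = length q'" "set p = set p'" "set q = set q'"
    "sum_list p = sum_list p'" "sum_list q = sum_list q'"
    using assms by (metis size_mset set_mset_mset sum_mset_sum_list)+
  ultimately show ?thesis
    by (simp add: majorized_def prob_vec_def decr_def)
qed

lemma decr_append_replicate_zero:
  assumes "\<forall>x\<in>set p. 0 \<le> x"
  shows "decr (p @ replicate m 0) = decr p @ replicate m 0"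
proof -
  have "sort (p @ replicate m 0) = replicate m 0 @ sort p"
    using assms by (intro properties_for_sort) (auto simp: sorted_append)
  then show ?thesis by (simp add: decr_def)
qed

lemma length_decr [simp]: "length (decr p) = length p"
  by (simp add: decr_def)

lemma sum_list_decr: "sum_list (decr p) = sum_list p"
  by (metis decr_def mset_rev mset_sort sum_mset_sum_list)

lemma majorized_append_zeros:
  assumes "majorized p q"
  shows "majorized (p @ replicate m 0) (q @ replicate m 0)"
proof -
  have len: "length p = length q" and pq: "prob_vec p" "prob_vec q"
    using assms by (simp_all add: majorized_def)
  have sum_take: "sum_list (take k (decr (x @ replicate m 0))) =
      sum_list (take (min k (length x)) (decr x))" if "prob_vec x" for x k
    using that by (cases "k \<le> length x")
      (simp_all add: prob_vec_def decr_append_replicate_zero sum_list_replicate min_def)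
  show ?thesis
    using assms pq
    by (simp add: majorized_def sum_take len) (auto simp: prob_vec_def sum_list_replicate)
qed

lemma sorted_decr: "sorted_wrt (\<ge>) (decr p)"
  by (simp add: decr_def sorted_wrt_rev)

lemma sum_list_take_ge_average:
  fixes xs :: "real list"
  assumes "sorted_wrt (\<ge>) xs" and "k \<le> length xs"
  shows "real k * sum_list xs \<le> real (length xs) * sum_list (take k xs)"
proof -
  let ?n = "length xs" and ?head = "\<lambda>i. of_bool (i < k) :: real"
  have "real ?n * (\<Sum>i=0..<?n. - ?head i * xs ! i) \<le> (\<Sum>i=0..<?n. - ?head i) * (\<Sum>i=0..<?n. xs ! i)"
    using assms(1) by (intro Chebyshev_sum_upper) (auto simp: sorted_wrt_iff_nth_less le_less)
  moreover have "(\<Sum>i=0..<?n. ?head i * xs ! i) = (\<Sum>i=0..<k. xs ! i)"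
    "(\<Sum>i=0..<?n. ?head i) = (\<Sum>i=0..<k. 1)"
    using assms(2) by (intro sum.mono_neutral_cong_right; auto)+
  ultimately show ?thesis using assms(2) by (simp add: sum_negf sum_list_sum_nth min_absorb2)
qed

lemma majorized_uniform:
  assumes "prob_vec q"
  shows "majorized (replicate (length q) (1 / real (length q))) q"
proof -
  let ?n = "length q"
  have n: "?n > 0" using assms by (auto simp: prob_vec_def)
  have "real k / real ?n \<le> sum_list (take k (decr q))" if "k \<le> ?n" for k
  proof -
    have "real k \<le> real ?n * sum_list (take k (decr q))"
      using sum_list_take_ge_average[OF sorted_decr, of k q] that assms
      by (simp add: sum_list_decr prob_vec_def)
    then show ?thesis using n by (simp add: divide_le_eq mult.commute)
  qed
  moreover have "decr (replicate ?n x) = replicate ?n x" for x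
    by (simp add: decr_def sorted_sort_id)
  ultimately show ?thesis
    using assms n by (simp add: majorized_def prob_vec_def sum_list_replicate min_absorb1)
qed

lemma majorized_flat:
  assumes p: "mset p = replicate_mset r (1 / real r) + replicate_mset m 0"
    and q: "prob_vec q" and len: "length p = length q" and m: "m \<le> count (mset q) 0"
  shows "majorized p q"
proof -
  obtain Y where Y: "mset q = replicate_mset m 0 + Y"
    using m by (auto simp: count_le_replicate_mset_subset_eq mset_subset_eq_exists_conv)
  obtain ys where ys: "mset ys = Y" using ex_mset by blast
  have mset_q: "mset q = mset (ys @ replicate m 0)" by (simp add: Y ys)
  then have "prob_vec (ys @ replicate m 0)"
    using q by (metis prob_vec_def set_mset_mset sum_mset_sum_list)
  then have "prob_vec ys" by (auto simp: prob_vec_def sum_list_replicate)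
  moreover have "length ys = r"
    using arg_cong[OF p, of size] arg_cong[OF mset_q, of size] len by simp
  ultimately have "majorized (replicate r (1 / real r) @ replicate m 0) (ys @ replicate m 0)"
    by (auto intro: majorized_append_zeros majorized_uniform)
  then show ?thesis
    using majorized_mset_cong[OF _ mset_q, of p "replicate r (1 / real r) @ replicate m 0"] p
    by simp
qed

section \<open>Spectra of quasi-idempotent matrices\<close>

lemma mtrace_smult: "A \<in> carrier_mat n n \<Longrightarrow> mtrace (c \<cdot>\<^sub>m A) = c * mtrace A"
  by (simp add: mtrace_def sum_distrib_left)

lemma mtrace_minus:
  "A \<in> carrier_mat n n \<Longrightarrow> B \<in> carrier_mat n n \<Longrightarrow> mtrace (A - B) = mtrace A - mtrace B"
  by (simp add: mtrace_def sum_subtractf)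

lemma mtrace_mult:
  assumes "A \<in> carrier_mat n m" "B \<in> carrier_mat m n"
  shows "mtrace (A * B) = (\<Sum>i<n. \<Sum>j<m. A $$ (i, j) * B $$ (j, i))"
  using assms by (auto simp: mtrace_def scalar_prod_def atLeast0LessThan intro!: sum.cong)

lemma mtrace_commute:
  assumes "A \<in> carrier_mat n m" "B \<in> carrier_mat m n"
  shows "mtrace (A * B) = mtrace (B * A)"
  unfolding mtrace_mult[OF assms] mtrace_mult[OF assms(2,1)]
  by (subst sum.swap) (simp add: mult.commute)

lemma mtrace_similar_mat_wit:
  assumes "A \<in> carrier_mat n n" and "similar_mat_wit A B P Q"
  shows "mtrace A = mtrace B"
proof -
  note wit = similar_mat_witD2[OF assms]
  have "mtrace A = mtrace (Q * (P * B))"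
    unfolding wit(3) using wit(5-7) by (intro mtrace_commute[of _ n n]) auto
  also have "Q * (P * B) = (Q * P) * B"
    using wit(5-7) by (simp add: assoc_mult_mat[of _ n n _ n _ n])
  also have "\<dots> = B" using wit(2,5) by simp
  finally show ?thesis .
qed

lemma proots_linear_factors: "proots (\<Prod>a\<leftarrow>as. [:- a, 1:]) = mset (as :: 'a :: idom list)"
  by (induction as)
    (simp_all add: proots_mult prod_list_zero_iff image_iff del: mult_pCons_left mult_pCons_right)

lemma mset_spec_vec: "mset (spec_vec A) = image_mset Re (proots (char_poly A))"
  by (simp add: spec_vec_def)

lemma char_poly_nonzero:
  fixes A :: "'a :: comm_ring_1 mat"
  assumes "A \<in> carrier_mat n n"
  shows "char_poly A \<noteq> 0"
  using degree_monic_char_poly[OF assms] by auto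

lemma mem_proots_char_poly_iff:
  fixes A :: "'a :: field mat"
  assumes "A \<in> carrier_mat n n"
  shows "e \<in># proots (char_poly A) \<longleftrightarrow> eigenvalue A e"
  using char_poly_nonzero[OF assms] eigenvalue_root_char_poly[OF assms] by simp

context
  fixes A :: "complex mat" and n :: nat
  assumes A: "A \<in> carrier_mat n n"
begin

lemma size_proots_char_poly: "size (proots (char_poly A)) = n"
  using degree_monic_char_poly[OF A] by (simp add: size_proots_complex)

lemma schur_decomposition_proots:
  assumes "mset es = proots (char_poly A)"
  obtains B P Q where "similar_mat_wit A B P Q" "upper_triangular B" "diag_mat B = es"
proof -
  obtain as where as: "char_poly A = (\<Prod>a\<leftarrow>as. [:- a, 1:])"
    using char_poly_factorized[OF A] by blast
  then have "mset es = mset as" using assms by (simp add: proots_linear_factors)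
  then have "mset (map (\<lambda>a. [:- a, 1:]) es) = mset (map (\<lambda>a. [:- a, 1:]) as)" by simp
  then have "char_poly A = (\<Prod>a\<leftarrow>es. [:- a, 1:])"
    unfolding as by (metis prod_mset_prod_list)
  moreover obtain B P Q where "schur_decomposition A es = (B, P, Q)" by (rule prod_cases3)
  ultimately show thesis using schur_decomposition[OF A] that by blast
qed

lemma mtrace_eq_sum_proots: "mtrace A = sum_mset (proots (char_poly A))"
proof -
  obtain es where es: "mset es = proots (char_poly A)" using ex_mset by blast
  then obtain B P Q where B: "similar_mat_wit A B P Q" "diag_mat B = es"
    using schur_decomposition_proots by metis
  have "mtrace B = sum_list (diag_mat B)"
    by (simp add: diag_mat_def mtrace_def interv_sum_list_conv_sum_set_nat atLeast0LessThan)
  then show ?thesis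
    using es B mtrace_similar_mat_wit[OF A] by (metis sum_mset_sum_list)
qed

lemma length_spec_vec: "length (spec_vec A) = n"
  by (simp only: size_mset[symmetric] mset_spec_vec size_image_mset size_proots_char_poly)

lemma sum_list_spec_vec: "sum_list (spec_vec A) = Re (mtrace A)"
proof -
  have "Re (sum_mset X) = sum_mset (image_mset Re X)" for X by (induction X) auto
  then show ?thesis
    by (metis mset_spec_vec mtrace_eq_sum_proots sum_mset_sum_list)
qed

end

lemma mult_upper_triangular_zero_columns:
  fixes R B :: "'a :: idom mat"
  assumes R: "R \<in> carrier_mat n' n" and B: "B \<in> carrier_mat n n" "upper_triangular B"
    and RB: "R * B = c \<cdot>\<^sub>m R" and diag: "\<And>j. j < m \<Longrightarrow> B $$ (j, j) \<noteq> c"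
    and i: "i < n'" and j: "j < m" and m: "m \<le> n"
  shows "R $$ (i, j) = 0"
  using j
proof (induction j rule: less_induct)
  case (less j)
  have "c * R $$ (i, j) = (R * B) $$ (i, j)" using RB R i m less.prems by simp
  also have "\<dots> = (\<Sum>k<n. R $$ (i, k) * B $$ (k, j))"
    using R B i m less.prems by (simp add: scalar_prod_def atLeast0LessThan)
  also have "\<dots> = (\<Sum>k<n. if k = j then R $$ (i, j) * B $$ (j, j) else 0)"
  proof (rule sum.cong[OF refl])
    fix k assume "k \<in> {..<n}"
    then show "R $$ (i, k) * B $$ (k, j) = (if k = j then R $$ (i, j) * B $$ (j, j) else 0)"
      using less B by (cases k j rule: linorder_cases) (auto simp: upper_triangular_def)
  qed
  finally have "c * R $$ (i, j) = B $$ (j, j) * R $$ (i, j)"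
    using less.prems m by (simp add: mult.commute)
  then show ?case using diag[OF less.prems] by simp
qed

lemma char_poly_zero_mat: "char_poly (0\<^sub>m m m :: 'a :: comm_ring_1 mat) = [:0, 1:] ^ m"
proof -
  have "upper_triangular (0\<^sub>m m m :: 'a mat)" by (auto simp: upper_triangular_def)
  then have "char_poly (0\<^sub>m m m :: 'a mat) = (\<Prod>a\<leftarrow>diag_mat (0\<^sub>m m m). [:- a, 1:])"
    by (intro char_poly_upper_triangular) auto
  also have "diag_mat (0\<^sub>m m m :: 'a mat) = replicate m 0"
    by (auto simp: diag_mat_def intro: nth_equalityI)
  finally show ?thesis by (simp add: prod_list_replicate)
qed

lemma zero_columns_le_count_proots:
  fixes R :: "complex mat"
  assumes R: "R \<in> carrier_mat n n" and m: "m \<le> n"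
    and zero: "\<And>i j. i < n \<Longrightarrow> j < m \<Longrightarrow> R $$ (i, j) = 0"
  shows "m \<le> count (proots (char_poly R)) 0"
proof -
  define C where "C = mat m (n - m) (\<lambda>(i, j). R $$ (i, j + m))"
  define D where "D = mat (n - m) (n - m) (\<lambda>(i, j). R $$ (i + m, j + m))"
  have block: "R = four_block_mat (0\<^sub>m m m) C (0\<^sub>m (n - m) m) D"
    using R m zero by (intro eq_matI) (auto simp: C_def D_def)
  have "char_poly R = char_poly (0\<^sub>m m m) * char_poly D"
    using char_poly_factorized[of "0\<^sub>m m m" m] char_poly_factorized[of D "n - m"]
    by (intro char_poly_0_block[OF block]) (auto simp: C_def D_def)
  then have "[:- 0, 1:] ^ m dvd char_poly R" by (simp add: char_poly_zero_mat)
  then show ?thesis using char_poly_nonzero[OF R] by (simp only: order_divides count_proots) simp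
qed

lemma similar_mat_wit_mult_eq_smult:
  assumes A: "A \<in> carrier_mat n n" and R: "R \<in> carrier_mat n n" and RA: "R * A = c \<cdot>\<^sub>m R"
    and wit: "similar_mat_wit A B P Q"
  shows "char_poly (Q * R * P) = char_poly R"
    and "(Q * R * P) * B = c \<cdot>\<^sub>m (Q * R * P)"
proof -
  note PQ = similar_mat_witD2[OF A wit]
  note [simp] = assoc_mult_mat[of _ n n _ n _ n]
  have "P * (Q * R * P) * Q = (P * Q) * R * (P * Q)" using PQ(4-7) R by simp
  then have "similar_mat_wit R (Q * R * P) P Q" using PQ R by (intro similar_mat_witI) auto
  then show "char_poly (Q * R * P) = char_poly R"
    by (intro char_poly_similar[symmetric]) (auto simp: similar_mat_def)
  have "(Q * R * P) * B = Q * (R * (P * B * Q)) * P" using PQ(4-7) R by (simp add: PQ(2))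
  also have "\<dots> = c \<cdot>\<^sub>m (Q * R * P)"
    unfolding PQ(3)[symmetric] RA using PQ(4-7) R
    by (simp add: mult_smult_distrib mult_smult_assoc_mat[of _ n n _ n])
  finally show "(Q * R * P) * B = c \<cdot>\<^sub>m (Q * R * P)" .
qed

text \<open>Triangularizing \<open>A\<close> with the eigenvalues different from \<open>c\<close> first makes the corresponding
  columns of the transformed \<open>R\<close> vanish.\<close>

lemma size_eigenvalues_neq_le_count_zero:
  fixes A R :: "complex mat"
  assumes A: "A \<in> carrier_mat n n" and R: "R \<in> carrier_mat n n" and RA: "R * A = c \<cdot>\<^sub>m R"
  shows "size (filter_mset (\<lambda>e. e \<noteq> c) (proots (char_poly A))) \<le> count (proots (char_poly R)) 0"
proof -
  obtain es fs where es: "mset es = filter_mset (\<lambda>e. e \<noteq> c) (proots (char_poly A))"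
    and fs: "mset fs = filter_mset (\<lambda>e. e = c) (proots (char_poly A))"
    by (metis ex_mset)
  have roots: "mset (es @ fs) = proots (char_poly A)"
    unfolding mset_append es fs by (subst multiset_partition[of _ "\<lambda>e. e \<noteq> c"]) simp
  then have len: "length (es @ fs) = n" using size_proots_char_poly[OF A] by (metis size_mset)
  obtain B P Q where wit: "similar_mat_wit A B P Q"
    and B: "upper_triangular B" "diag_mat B = es @ fs"
    by (rule schur_decomposition_proots[OF A roots])
  note PQ = similar_mat_witD2[OF A wit] and QRP = similar_mat_wit_mult_eq_smult[OF A R RA wit]
  have QRP_carrier: "Q * R * P \<in> carrier_mat n n" using PQ R by simp
  have diag: "B $$ (j, j) \<noteq> c" if "j < length es" for j
  proof -
    have "B $$ (j, j) = diag_mat B ! j" using that len PQ(5) by (auto simp: diag_mat_def)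
    then have "B $$ (j, j) \<in># mset es" using that by (simp add: B(2) nth_append)
    then show ?thesis by (simp add: es)
  qed
  have "length es \<le> count (proots (char_poly (Q * R * P))) 0"
  proof (rule zero_columns_le_count_proots[OF QRP_carrier])
    show "(Q * R * P) $$ (i, j) = 0" if "i < n" "j < length es" for i j
      using that len
        mult_upper_triangular_zero_columns[OF QRP_carrier PQ(5) B(1) QRP(2) diag, of "length es"]
      by simp
  qed (use len in simp)
  then show ?thesis by (simp add: QRP(1) flip: es)
qed

lemma eigenvalue_quasi_idempotent:
  fixes A :: "'a :: field mat"
  assumes A: "A \<in> carrier_mat n n" and AA: "A * A = c \<cdot>\<^sub>m A" and e: "eigenvalue A e"
  shows "e = 0 \<or> e = c"
proof -
  obtain v where v: "v \<in> carrier_vec n" "v \<noteq> 0\<^sub>v n" "A *\<^sub>v v = e \<cdot>\<^sub>v v"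
    using e A by (auto simp: eigenvalue_def eigenvector_def)
  have "(c * e) \<cdot>\<^sub>v v = c \<cdot>\<^sub>v (A *\<^sub>v v)" by (simp add: v(3) smult_smult_assoc)
  also have "\<dots> = (A * A) *\<^sub>v v"
    unfolding AA using A v(1) by (intro eq_vecI) auto
  also have "\<dots> = (e * e) \<cdot>\<^sub>v v" using A v by (simp add: mult_mat_vec smult_smult_assoc)
  finally have "((c - e) * e) \<cdot>\<^sub>v v = 0\<^sub>v n"
    using v(1) by (auto simp: vec_eq_iff algebra_simps)
  then show ?thesis using v(1,2) by (auto simp: vec_eq_iff)
qed

lemma proots_quasi_idempotent:
  fixes A :: "'a :: field mat"
  assumes A: "A \<in> carrier_mat n n" and AA: "A * A = c \<cdot>\<^sub>m A"
  defines "X \<equiv> proots (char_poly A)"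
  shows "X = replicate_mset (count X c) c + replicate_mset (size (filter_mset (\<lambda>e. e \<noteq> c) X)) 0"
proof -
  have "filter_mset (\<lambda>e. e \<noteq> c) X = replicate_mset (size (filter_mset (\<lambda>e. e \<noteq> c) X)) 0"
    using eigenvalue_quasi_idempotent[OF A AA] mem_proots_char_poly_iff[OF A]
    by (intro set_mset_subset_singletonD) (auto simp: X_def)
  then show ?thesis
    using multiset_partition[of X "\<lambda>e. e = c"] by (simp add: filter_eq_replicate_mset)
qed

theorem majorized_spec_vec_quasi_idempotent:
  fixes A R :: "complex mat"
  assumes A: "A \<in> carrier_mat n n" and R: "R \<in> carrier_mat n n"
    and AA: "A * A = c \<cdot>\<^sub>m A" and RA: "R * A = c \<cdot>\<^sub>m R"
    and trace: "mtrace A = 1" and prob: "prob_vec (spec_vec R)"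
  shows "majorized (spec_vec A) (spec_vec R)"
proof -
  let ?X = "proots (char_poly A)" and ?Y = "proots (char_poly R)"
  define r where "r = count ?X c"
  define m where "m = size (filter_mset (\<lambda>e. e \<noteq> c) ?X)"
  have X: "?X = replicate_mset r c + replicate_mset m 0"
    unfolding r_def m_def by (rule proots_quasi_idempotent[OF A AA])
  have "of_nat r * c = 1" using mtrace_eq_sum_proots[OF A] trace by (simp add: X)
  then have c: "c = of_real (1 / real r)"
    by (cases "r = 0") (simp_all add: eq_divide_eq mult.commute)
  show ?thesis
  proof (rule majorized_flat)
    show "mset (spec_vec A) = replicate_mset r (1 / real r) + replicate_mset m 0"
      by (simp add: mset_spec_vec X c)
    show "length (spec_vec A) = length (spec_vec R)"
      by (simp only: length_spec_vec[OF A] length_spec_vec[OF R])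
    have "replicate_mset m 0 \<subseteq># ?Y"
      using size_eigenvalues_neq_le_count_zero[OF A R RA]
      by (simp add: m_def count_le_replicate_mset_subset_eq)
    then have "image_mset Re (replicate_mset m 0) \<subseteq># mset (spec_vec R)"
      unfolding mset_spec_vec by (rule image_mset_subseteq_mono)
    then show "m \<le> count (mset (spec_vec R)) 0"
      by (simp add: count_le_replicate_mset_subset_eq)
  qed (rule prob)
qed

section \<open>Adjoints and positive semidefinite matrices\<close>

lemma dim_mat_adjoint [simp]:
  "dim_row (mat_adjoint A) = dim_col A" "dim_col (mat_adjoint A) = dim_row A"
  by (simp_all add: mat_adjoint_def)

lemma mat_adjoint_carrier [simp]: "A \<in> carrier_mat n m \<Longrightarrow> mat_adjoint A \<in> carrier_mat m n"
  by (intro carrier_matI) auto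

lemma index_mat_adjoint [simp]:
  "i < dim_col A \<Longrightarrow> j < dim_row A \<Longrightarrow> mat_adjoint A $$ (i, j) = conjugate (A $$ (j, i))"
  by (simp add: mat_adjoint_def mat_of_rows_def)

lemma mat_adjoint_adjoint [simp]: "mat_adjoint (mat_adjoint A) = A"
  by (intro eq_matI) simp_all

lemma mat_adjoint_mult:
  fixes A B :: "'a :: conjugatable_field mat"
  assumes "A \<in> carrier_mat n m" "B \<in> carrier_mat m k"
  shows "mat_adjoint (A * B) = mat_adjoint B * mat_adjoint A"
  using assms
  by (intro eq_matI)
    (auto simp: scalar_prod_def sum_conjugate conjugate_dist_mul mult.commute intro!: sum.cong)

lemma mtrace_adjoint:
  assumes "A \<in> carrier_mat n n"
  shows "mtrace (mat_adjoint A) = cnj (mtrace A)"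
  using assms by (simp add: mtrace_def)

lemma mtrace_mult_adjoint:
  assumes A: "A \<in> carrier_mat n m" and B: "B \<in> carrier_mat n m"
  shows "mtrace (A * mat_adjoint B) = cnj (mtrace (mat_adjoint A * B))"
proof -
  have "mtrace (A * mat_adjoint B) = mtrace (mat_adjoint B * A)"
    using A B by (intro mtrace_commute) auto
  also have "\<dots> = mtrace (mat_adjoint (mat_adjoint A * B))"
    using A B by (simp add: mat_adjoint_mult[of _ m n _ m])
  also have "\<dots> = cnj (mtrace (mat_adjoint A * B))"
    by (rule mtrace_adjoint[OF mult_carrier_mat[OF mat_adjoint_carrier[OF A] B]])
  finally show ?thesis .
qed

lemma cscalar_prod_mat_adjoint:
  fixes A :: "'a :: conjugatable_field mat"
  assumes "A \<in> carrier_mat n m" "v \<in> carrier_vec m" "w \<in> carrier_vec n"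
  shows "(A *\<^sub>v v) \<bullet>c w = v \<bullet>c (mat_adjoint A *\<^sub>v w)"
proof -
  have "(A *\<^sub>v v) \<bullet>c w = (\<Sum>i<n. \<Sum>j<m. A $$ (i, j) * v $ j * conjugate (w $ i))"
    using assms by (simp add: scalar_prod_def atLeast0LessThan sum_distrib_right)
  also have "\<dots> = (\<Sum>j<m. \<Sum>i<n. A $$ (i, j) * v $ j * conjugate (w $ i))" by (rule sum.swap)
  also have "\<dots> = v \<bullet>c (mat_adjoint A *\<^sub>v w)"
    using assms by (simp add: scalar_prod_def atLeast0LessThan sum_distrib_left sum_conjugate
        conjugate_dist_mul mult_ac)
  finally show ?thesis .
qed

definition psd_mat :: "nat \<Rightarrow> complex mat \<Rightarrow> bool" where
  "psd_mat n A \<longleftrightarrow> A \<in> carrier_mat n n \<and> mat_adjoint A = A \<and>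
     (\<forall>v \<in> carrier_vec n. 0 \<le> (A *\<^sub>v v) \<bullet>c v)"

context
  fixes n :: nat and A :: "complex mat"
  assumes psd: "psd_mat n A"
begin

lemma psd_mat_carrier: "A \<in> carrier_mat n n"
  and psd_mat_hermitian: "mat_adjoint A = A"
  and psd_mat_nonneg: "v \<in> carrier_vec n \<Longrightarrow> 0 \<le> (A *\<^sub>v v) \<bullet>c v"
  using psd by (simp_all add: psd_mat_def)

lemma psd_mat_eigenvalue_nonneg:
  assumes "eigenvalue A e"
  shows "0 \<le> e"
proof -
  obtain v where v: "v \<in> carrier_vec n" "v \<noteq> 0\<^sub>v n" "A *\<^sub>v v = e \<cdot>\<^sub>v v"
    using assms psd_mat_carrier by (auto simp: eigenvalue_def eigenvector_def)
  then have "0 \<le> e * (v \<bullet>c v)"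
    using psd_mat_nonneg[OF v(1)] by (simp add: smult_scalar_prod_distrib[of _ n])
  moreover have "0 < v \<bullet>c v" using v by simp
  ultimately show ?thesis by (auto simp: less_eq_complex_def less_complex_def zero_le_mult_iff)
qed

text \<open>Otherwise the quadratic form would be negative at \<open>v - t A v\<close> for small \<open>t > 0\<close>.\<close>

lemma psd_mat_kernel:
  assumes v: "v \<in> carrier_vec n" and zero: "(A *\<^sub>v v) \<bullet>c v = 0"
  shows "A *\<^sub>v v = 0\<^sub>v n"
proof (rule ccontr)
  note A = psd_mat_carrier
  define w where "w = A *\<^sub>v v"
  have w: "w \<in> carrier_vec n" using A v by (simp add: w_def)
  assume "\<not> ?thesis"
  then have pos: "0 < w \<bullet>c w" using w by (simp add: w_def)
  have ge: "0 \<le> (A *\<^sub>v w) \<bullet>c w" by (rule psd_mat_nonneg[OF w])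
  define a where "a = Re (w \<bullet>c w)"
  define b where "b = Re ((A *\<^sub>v w) \<bullet>c w)"
  have a: "w \<bullet>c w = of_real a" "0 < a" and b: "(A *\<^sub>v w) \<bullet>c w = of_real b" "0 \<le> b"
    using pos ge by (auto simp: a_def b_def complex_eq_iff less_complex_def less_eq_complex_def)
  have wv: "(A *\<^sub>v w) \<bullet>c v = of_real a"
    using cscalar_prod_mat_adjoint[OF A w v] by (simp add: psd_mat_hermitian a(1) flip: w_def)
  define t where "t = a / (b + 1)"
  have t: "0 < t" "t * b < a" using a b by (simp_all add: t_def field_simps)
  let ?u = "v + of_real (- t) \<cdot>\<^sub>v w"
  have u: "?u \<in> carrier_vec n" using v w by simp
  have "(A *\<^sub>v ?u) \<bullet>c ?u = of_real (t * (t * b - 2 * a))"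
    using A v w zero a b wv
    by (simp add: mult_add_distrib_mat_vec[of _ n n] mult_mat_vec[of _ n n]
        conjugate_add_vec[of _ n] conjugate_smult_vec
        add_scalar_prod_distrib[of _ n] scalar_prod_add_distrib[of _ n]
        smult_scalar_prod_distrib[of _ n] scalar_prod_smult_distrib[of _ n]
        right_diff_distrib flip: w_def)
  then have "0 \<le> t * (t * b - 2 * a)"
    using psd_mat_nonneg[OF u] by (simp add: less_eq_complex_def)
  then show False using t a(2) by (simp add: zero_le_mult_iff)
qed

lemma psd_mat_mult_eq_zero:
  assumes K: "K \<in> carrier_mat n m" and zero: "mtrace (mat_adjoint K * A * K) = 0"
  shows "A * K = 0\<^sub>m n m"
proof -
  note A = psd_mat_carrier
  let ?q = "\<lambda>k. (A *\<^sub>v col K k) \<bullet>c col K k"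
  have col: "col K k \<in> carrier_vec n" for k using K by auto
  have "mtrace (mat_adjoint K * (A * K)) = (\<Sum>k<m. ?q k)"
    unfolding mtrace_def using A K
    by (auto simp: scalar_prod_def mult.commute intro!: sum.cong)
  then have "(\<Sum>k<m. ?q k) = 0"
    using zero A K by (simp add: assoc_mult_mat[of _ m n _ n _ m])
  then have "?q k = 0" if "k < m" for k
    using that sum_nonneg_eq_0_iff[of "{..<m}" ?q] psd_mat_nonneg[OF col] by simp
  then have zero_col: "A *\<^sub>v col K k = 0\<^sub>v n" if "k < m" for k
    using that psd_mat_kernel[OF col] by simp
  show ?thesis
  proof (rule eq_matI)
    fix i k assume "i < dim_row (0\<^sub>m n m :: complex mat)" "k < dim_col (0\<^sub>m n m :: complex mat)"
    then have ik: "i < n" "k < m" by simp_all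
    then have "(A * K) $$ (i, k) = (A *\<^sub>v col K k) $ i" using A K by simp
    then show "(A * K) $$ (i, k) = 0\<^sub>m n m $$ (i, k)" using zero_col ik by simp
  qed (use A K in auto)
qed

text \<open>Equality in the Cauchy--Schwarz inequality: for \<open>\<xi> = Tr (A U)\<close> of modulus one, the
  expectation of \<open>(U - \<xi>) (U - \<xi>)\<^sup>\<dagger>\<close> vanishes.\<close>

lemma psd_mat_unimodular_expectation:
  assumes trace: "mtrace A = 1" and U: "U \<in> carrier_mat n n" "U * mat_adjoint U = 1\<^sub>m n"
    and one: "cmod (mtrace (A * U)) = 1"
  shows "A * U = mtrace (A * U) \<cdot>\<^sub>m A"
proof -
  note A = psd_mat_carrier
  define \<xi> where "\<xi> = mtrace (A * U)"
  have \<xi>: "\<xi> * cnj \<xi> = 1" using one by (simp add: \<xi>_def complex_norm_square[symmetric])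
  have adj: "mat_adjoint U \<in> carrier_mat n n" using U by simp
  have adj_trace: "mtrace (A * mat_adjoint U) = cnj \<xi>"
    unfolding \<xi>_def mtrace_mult_adjoint[OF A U(1)] psd_mat_hermitian ..
  define K where "K = U - \<xi> \<cdot>\<^sub>m 1\<^sub>m n"
  have K: "K \<in> carrier_mat n n" using U unfolding K_def by (intro minus_carrier_mat) auto
  have K_adj: "mat_adjoint K = mat_adjoint U - cnj \<xi> \<cdot>\<^sub>m 1\<^sub>m n"
    using U by (intro eq_matI) (auto simp: K_def)
  have AK: "A * K = A * U - \<xi> \<cdot>\<^sub>m A"
    unfolding K_def using A U
    by (simp add: mult_minus_distrib_mat[of _ n n] mult_smult_distrib[of _ n n _ n])
  have "mtrace (A * K) = 0"
    using A U trace by (simp add: AK mtrace_minus[of _ n] mtrace_smult[of _ n] \<xi>_def)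
  moreover have "mtrace (A * K * mat_adjoint U) = 0"
  proof -
    have "A * K * mat_adjoint U = A - \<xi> \<cdot>\<^sub>m (A * mat_adjoint U)"
      unfolding AK using A U adj
      by (simp add: minus_mult_distrib_mat[of _ n n _ _ n] mult_smult_assoc_mat[of _ n n _ n]
          assoc_mult_mat[of _ n n _ n _ n])
    then show ?thesis
      using A adj trace \<xi> by (simp add: mtrace_minus[of _ n] mtrace_smult[of _ n] adj_trace)
  qed
  moreover have "mtrace (mat_adjoint K * A * K) = mtrace (A * K * mat_adjoint K)"
    using A K by (simp add: assoc_mult_mat[of _ n n _ n _ n] mtrace_commute[of "mat_adjoint K" n n])
  moreover have "A * K * mat_adjoint K = A * K * mat_adjoint U - cnj \<xi> \<cdot>\<^sub>m (A * K)"
    unfolding K_adj using A K adj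
    by (simp add: mult_minus_distrib_mat[of _ n n] mult_smult_distrib[of _ n n _ n])
  ultimately have "A * K = 0\<^sub>m n n"
    using A K adj
    by (intro psd_mat_mult_eq_zero) (simp_all add: mtrace_minus[of _ n] mtrace_smult[of _ n])
  moreover have "A * U = A * K + \<xi> \<cdot>\<^sub>m A"
    unfolding AK using A U by (intro eq_matI) auto
  ultimately show ?thesis using A by (simp add: \<xi>_def)
qed

end

lemma is_state_imp_psd_mat:
  assumes "is_state d n \<rho>"
  shows "psd_mat (d ^ n) \<rho>" and "mtrace \<rho> = 1"
proof -
  let ?form = "\<lambda>v. \<Sum>i<d ^ n. \<Sum>j<d ^ n. cnj (v i) * \<rho> $$ (i, j) * v j"
  from assms have \<rho>: "\<rho> \<in> carrier_mat (d ^ n) (d ^ n)" and trace: "mtrace \<rho> = 1"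
    and hermitian: "\<forall>i<d ^ n. \<forall>j<d ^ n. \<rho> $$ (i, j) = cnj (\<rho> $$ (j, i))"
    and form: "\<forall>v. Im (?form v) = 0 \<and> 0 \<le> Re (?form v)"
    unfolding is_state_def Let_def by blast+
  from hermitian have "cnj (\<rho> $$ (j, i)) = \<rho> $$ (i, j)" if "i < d ^ n" "j < d ^ n" for i j
    using that by metis
  then have "mat_adjoint \<rho> = \<rho>" using \<rho> by (intro eq_matI) simp_all
  moreover have "0 \<le> (\<rho> *\<^sub>v v) \<bullet>c v" if "v \<in> carrier_vec (d ^ n)" for v
  proof -
    have "(\<rho> *\<^sub>v v) \<bullet>c v = ?form (($) v)"
      using that \<rho> by (simp add: scalar_prod_def atLeast0LessThan sum_distrib_left mult_ac)
    also have "0 \<le> \<dots>"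
      using form[THEN spec, of "($) v"] by (simp only: less_eq_complex_def zero_complex.sel)
    finally show ?thesis .
  qed
  ultimately show "psd_mat (d ^ n) \<rho>"
    using \<rho> by (simp add: psd_mat_def)
  show "mtrace \<rho> = 1" by (rule trace)
qed

lemma psd_mat_prob_vec_spec_vec:
  assumes "psd_mat n A" "mtrace A = 1"
  shows "prob_vec (spec_vec A)"
proof -
  note A = psd_mat_carrier[OF assms(1)]
  have "0 \<le> Re e" if "e \<in># proots (char_poly A)" for e
    using that psd_mat_eigenvalue_nonneg[OF assms(1)] mem_proots_char_poly_iff[OF A]
    by (simp add: less_eq_complex_def)
  then have "\<forall>x\<in>#mset (spec_vec A). 0 \<le> x" by (auto simp: mset_spec_vec)
  then show ?thesis using sum_list_spec_vec[OF A] assms(2) by (simp add: prob_vec_def)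
qed

section \<open>Nice error bases\<close>

locale nice_error_basis =
  fixes N :: nat and X :: "'x set" and W :: "'x \<Rightarrow> complex mat"
  assumes finite_X: "finite X" and N_pos: "0 < N"
    and W_carrier: "x \<in> X \<Longrightarrow> W x \<in> carrier_mat N N"
    and unitary: "x \<in> X \<Longrightarrow> W x * mat_adjoint (W x) = 1\<^sub>m N"
    and complete: "\<lbrakk>a < N; b < N; i < N; j < N\<rbrakk> \<Longrightarrow>
      (\<Sum>x\<in>X. W x $$ (a, b) * cnj (W x $$ (i, j))) = of_nat N * of_bool (a = i \<and> b = j)"
    and mult_closed: "\<lbrakk>x \<in> X; y \<in> X\<rbrakk> \<Longrightarrow> \<exists>z\<in>X. \<exists>\<omega>. cmod \<omega> = 1 \<and> W x * W y = \<omega> \<cdot>\<^sub>m W z"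
    and one_closed: "\<exists>x\<in>X. W x = 1\<^sub>m N"
begin

lemma dim_W [simp]:
  assumes "x \<in> X"
  shows "dim_row (W x) = N" "dim_col (W x) = N"
  using W_carrier[OF assms] by auto

definition expand :: "('x \<Rightarrow> complex) \<Rightarrow> complex mat" where
  "expand f = mat N N (\<lambda>(i, j). \<Sum>x\<in>X. f x * cnj (W x $$ (j, i)))"

lemma expand_carrier [simp]: "expand f \<in> carrier_mat N N"
  by (simp add: expand_def)

lemma index_mult_expand:
  assumes A: "A \<in> carrier_mat N N" and ij: "i < N" "j < N"
  shows "(A * expand f) $$ (i, j) = (\<Sum>x\<in>X. f x * (A * mat_adjoint (W x)) $$ (i, j))"
proof -
  have "(A * expand f) $$ (i, j) = (\<Sum>k<N. \<Sum>x\<in>X. A $$ (i, k) * (f x * cnj (W x $$ (j, k))))"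
    using A ij by (simp add: scalar_prod_def atLeast0LessThan expand_def sum_distrib_left)
  also have "\<dots> = (\<Sum>x\<in>X. \<Sum>k<N. A $$ (i, k) * (f x * cnj (W x $$ (j, k))))" by (rule sum.swap)
  also have "\<dots> = (\<Sum>x\<in>X. f x * (A * mat_adjoint (W x)) $$ (i, j))"
    using A ij
    by (intro sum.cong refl) (simp add: scalar_prod_def atLeast0LessThan sum_distrib_left mult_ac)
  finally show ?thesis .
qed

lemma mtrace_mult_expand:
  assumes "A \<in> carrier_mat N N"
  shows "mtrace (A * expand f) = (\<Sum>x\<in>X. f x * mtrace (A * mat_adjoint (W x)))"
  using assms
  by (simp add: mtrace_def index_mult_expand sum_distrib_left sum.swap[of _ X])

lemma expand_mtrace:
  assumes A: "A \<in> carrier_mat N N"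
  shows "expand (\<lambda>x. mtrace (A * W x)) = of_nat N \<cdot>\<^sub>m A"
proof (rule eq_matI)
  fix i j assume "i < dim_row (of_nat N \<cdot>\<^sub>m A)" "j < dim_col (of_nat N \<cdot>\<^sub>m A)"
  then have ij: "i < N" "j < N" using A by auto
  have "expand (\<lambda>x. mtrace (A * W x)) $$ (i, j) =
      (\<Sum>x\<in>X. \<Sum>a<N. \<Sum>b<N. A $$ (a, b) * (W x $$ (b, a) * cnj (W x $$ (j, i))))"
    using ij W_carrier
    by (simp add: expand_def mtrace_mult[OF A] sum_distrib_right mult.assoc)
  also have "\<dots> = (\<Sum>a<N. \<Sum>b<N. A $$ (a, b) * (\<Sum>x\<in>X. W x $$ (b, a) * cnj (W x $$ (j, i))))"
    by (simp add: sum.swap[of _ X] sum_distrib_left)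
  also have "\<dots> = (\<Sum>a<N. \<Sum>b<N. if b = j then if a = i then of_nat N * A $$ (i, j) else 0 else 0)"
    using ij by (intro sum.cong refl) (auto simp: complete)
  also have "\<dots> = of_nat N * A $$ (i, j)" using ij by simp
  finally show "expand (\<lambda>x. mtrace (A * W x)) $$ (i, j) = (of_nat N \<cdot>\<^sub>m A) $$ (i, j)"
    using A ij by simp
qed (use A in \<open>auto simp: expand_def\<close>)

lemma eq_by_mtrace:
  assumes A: "A \<in> carrier_mat N N" and B: "B \<in> carrier_mat N N"
    and eq: "\<And>x. x \<in> X \<Longrightarrow> mtrace (A * W x) = mtrace (B * W x)"
  shows "A = B"
proof -
  have "expand (\<lambda>x. mtrace (A * W x)) = expand (\<lambda>x. mtrace (B * W x))"
    by (simp add: expand_def eq cong: sum.cong)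
  then have "of_nat N \<cdot>\<^sub>m A = of_nat N \<cdot>\<^sub>m B" by (simp only: expand_mtrace A B)
  then have "of_nat N * A $$ (i, j) = of_nat N * B $$ (i, j)" if "i < N" "j < N" for i j
    using A B that by (metis carrier_matD index_smult_mat(1))
  then show ?thesis using A B N_pos by (intro eq_matI) auto
qed

lemma sum_cmod_mtrace_square:
  assumes A: "A \<in> carrier_mat N N"
  shows "of_real (\<Sum>x\<in>X. (cmod (mtrace (mat_adjoint A * W x)))\<^sup>2) =
    of_nat N * mtrace (A * mat_adjoint A)"
proof -
  let ?g = "\<lambda>x. mtrace (mat_adjoint A * W x)"
  have "of_real (\<Sum>x\<in>X. (cmod (?g x))\<^sup>2) = (\<Sum>x\<in>X. ?g x * mtrace (A * mat_adjoint (W x)))"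
    by (simp add: mtrace_mult_adjoint[OF A W_carrier] complex_norm_square del: of_real_power)
  also have "\<dots> = mtrace (A * expand ?g)" using A by (simp add: mtrace_mult_expand)
  also have "expand ?g = of_nat N \<cdot>\<^sub>m mat_adjoint A" using A by (intro expand_mtrace) simp
  also have "mtrace (A * \<dots>) = of_nat N * mtrace (A * mat_adjoint A)"
    using A by (simp add: mult_smult_distrib[of _ N N _ N] mtrace_smult[of _ N])
  finally show ?thesis .
qed

text \<open>For \<open>A = W x\<close> the total in the preceding identity is \<open>N\<^sup>2\<close>, which the term of \<open>x\<close> alone
  exhausts.\<close>

lemma orthogonal:
  assumes x: "x \<in> X" and y: "y \<in> X"
  shows "mtrace (mat_adjoint (W x) * W y) = (if x = y then of_nat N else 0)"
proof -
  note Wx = W_carrier[OF x]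
  let ?g = "\<lambda>z. mtrace (mat_adjoint (W x) * W z)"
  have self: "?g x = of_nat N"
  proof -
    have "?g x = mtrace (W x * mat_adjoint (W x))" using Wx by (intro mtrace_commute) auto
    then show ?thesis by (simp add: unitary[OF x] mtrace_def)
  qed
  have "of_real (\<Sum>z\<in>X. (cmod (?g z))\<^sup>2) = complex_of_real ((real N)\<^sup>2)"
    unfolding sum_cmod_mtrace_square[OF Wx] unitary[OF x] by (simp add: mtrace_def power2_eq_square)
  then have "(\<Sum>z\<in>X. (cmod (?g z))\<^sup>2) = (real N)\<^sup>2" by (simp only: of_real_eq_iff)
  then have "(\<Sum>z\<in>X - {x}. (cmod (?g z))\<^sup>2) = 0"
    using finite_X x by (simp add: sum.remove self)
  then have "?g y = 0" if "y \<noteq> x"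
    using finite_X y that by (simp add: sum_nonneg_eq_0_iff)
  then show ?thesis using self by auto
qed

lemma mtrace_expand:
  assumes y: "y \<in> X"
  shows "mtrace (expand f * W y) = of_nat N * f y"
proof -
  have "mtrace (expand f * W y) = mtrace (W y * expand f)"
    using W_carrier[OF y] by (intro mtrace_commute) auto
  also have "\<dots> = (\<Sum>x\<in>X. f x * mtrace (mat_adjoint (W x) * W y))"
    unfolding mtrace_mult_expand[OF W_carrier[OF y]]
    using W_carrier y by (intro sum.cong refl) (simp add: mtrace_commute[of "W y" N N])
  also have "\<dots> = (\<Sum>x\<in>X. if x = y then of_nat N * f y else 0)"
    using y by (intro sum.cong) (auto simp: orthogonal)
  finally show ?thesis using y finite_X by simp
qed

definition stabilizer :: "complex mat \<Rightarrow> 'x set" where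
  "stabilizer \<rho> = {x \<in> X. cmod (mtrace (\<rho> * W x)) = 1}"

definition mean :: "complex mat \<Rightarrow> complex mat" where
  "mean \<rho> = expand (\<lambda>x. if x \<in> stabilizer \<rho> then mtrace (\<rho> * W x) / of_nat N else 0)"

lemma mean_carrier [simp]: "mean \<rho> \<in> carrier_mat N N"
  by (simp add: mean_def)

lemma mtrace_mean:
  "x \<in> X \<Longrightarrow> mtrace (mean \<rho> * W x) =
    (if cmod (mtrace (\<rho> * W x)) = 1 then mtrace (\<rho> * W x) else 0)"
  using N_pos by (simp add: mean_def mtrace_expand stabilizer_def)

lemma mult_mean:
  assumes A: "A \<in> carrier_mat N N"
    and stab: "\<And>x. x \<in> stabilizer \<rho> \<Longrightarrow> A * W x = mtrace (\<rho> * W x) \<cdot>\<^sub>m A"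
  shows "A * mean \<rho> = (of_nat (card (stabilizer \<rho>)) / of_nat N) \<cdot>\<^sub>m A"
proof (rule eq_matI)
  let ?S = "stabilizer \<rho>" and ?g = "\<lambda>x. mtrace (\<rho> * W x)"
  fix i j assume "i < dim_row ((of_nat (card ?S) / of_nat N) \<cdot>\<^sub>m A)"
    "j < dim_col ((of_nat (card ?S) / of_nat N) \<cdot>\<^sub>m A)"
  then have ij: "i < N" "j < N" using A by auto
  have absorb: "?g x * (A * mat_adjoint (W x)) $$ (i, j) = A $$ (i, j)" if x: "x \<in> ?S" for x
  proof -
    have W: "W x \<in> carrier_mat N N" "W x * mat_adjoint (W x) = 1\<^sub>m N"
      using x by (auto simp: stabilizer_def W_carrier unitary)
    have "A = (A * W x) * mat_adjoint (W x)"
      using A W by (simp add: assoc_mult_mat[of _ N N _ N _ N])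
    also have "\<dots> = ?g x \<cdot>\<^sub>m (A * mat_adjoint (W x))"
      unfolding stab[OF x] using A W by (intro mult_smult_assoc_mat) auto
    finally have "A $$ (i, j) = (?g x \<cdot>\<^sub>m (A * mat_adjoint (W x))) $$ (i, j)" by simp
    then show ?thesis using A W ij by simp
  qed
  have "(A * mean \<rho>) $$ (i, j) = (\<Sum>x\<in>X. if x \<in> ?S then A $$ (i, j) / of_nat N else 0)"
    unfolding mean_def index_mult_expand[OF A ij] using absorb by (intro sum.cong) auto
  also have "\<dots> = of_nat (card ?S) / of_nat N * A $$ (i, j)"
    using finite_X by (simp add: stabilizer_def sum.If_cases Int_def)
  finally show "(A * mean \<rho>) $$ (i, j) = ((of_nat (card ?S) / of_nat N) \<cdot>\<^sub>m A) $$ (i, j)"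
    using A ij by simp
qed (simp_all add: carrier_matD[OF A] carrier_matD[OF mean_carrier])

lemma mtrace_mult_closed:
  assumes "x \<in> X" "y \<in> X"
  obtains z \<omega> where "z \<in> X" "cmod \<omega> = 1"
    "\<And>A. A \<in> carrier_mat N N \<Longrightarrow> mtrace (A * W x * W y) = \<omega> * mtrace (A * W z)"
proof -
  note W = W_carrier[OF assms(1)] W_carrier[OF assms(2)]
  obtain z \<omega> where z: "z \<in> X" "cmod \<omega> = 1" "W x * W y = \<omega> \<cdot>\<^sub>m W z"
    using mult_closed[OF assms] by blast
  have "mtrace (A * W x * W y) = \<omega> * mtrace (A * W z)" if A: "A \<in> carrier_mat N N" for A
  proof -
    have "A * W x * W y = \<omega> \<cdot>\<^sub>m (A * W z)"
      using A W W_carrier[OF z(1)]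
      by (simp add: assoc_mult_mat[of _ N N _ N _ N] z(3) mult_smult_distrib[of _ N N _ N])
    then show ?thesis using A W_carrier[OF z(1)] by (simp add: mtrace_smult[of _ N])
  qed
  then show thesis using that z by blast
qed

context
  fixes \<rho> :: "complex mat"
  assumes psd: "psd_mat N \<rho>" and trace: "mtrace \<rho> = 1"
begin

lemmas state_carrier = psd_mat_carrier[OF psd]

lemma stabilizer_state:
  assumes "x \<in> stabilizer \<rho>"
  shows "\<rho> * W x = mtrace (\<rho> * W x) \<cdot>\<^sub>m \<rho>"
  using assms psd_mat_unimodular_expectation[OF psd trace W_carrier unitary]
  by (simp add: stabilizer_def)

text \<open>Right multiplication by \<open>W y\<close> permutes the basis up to phases without changing the moduli
  of the coefficients of \<open>\<rho>\<close>, hence commutes with passing to the mean.\<close>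

lemma stabilizer_mean:
  assumes y: "y \<in> stabilizer \<rho>"
  shows "mean \<rho> * W y = mtrace (\<rho> * W y) \<cdot>\<^sub>m mean \<rho>"
proof (rule eq_by_mtrace)
  let ?g = "\<lambda>x. mtrace (\<rho> * W x)"
  have yX: "y \<in> X" and g_y: "cmod (?g y) = 1" using y by (auto simp: stabilizer_def)
  note Wy = W_carrier[OF yX]
  show "mean \<rho> * W y \<in> carrier_mat N N" "?g y \<cdot>\<^sub>m mean \<rho> \<in> carrier_mat N N"
    using mult_carrier_mat[OF mean_carrier Wy] by auto
  fix x assume x: "x \<in> X"
  note Wx = W_carrier[OF x]
  obtain z \<omega> where z: "z \<in> X" "cmod \<omega> = 1"
    and shift: "\<And>A. A \<in> carrier_mat N N \<Longrightarrow> mtrace (A * W y * W x) = \<omega> * mtrace (A * W z)"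
    using mtrace_mult_closed[OF yX x] by blast
  have scale: "mtrace (c \<cdot>\<^sub>m A * W x) = c * mtrace (A * W x)" if "A \<in> carrier_mat N N" for c A
    using that Wx by (simp add: mult_smult_assoc_mat[of _ N N _ N] mtrace_smult[of _ N])
  have "mtrace (\<rho> * W y * W x) = ?g y * ?g x"
    by (subst stabilizer_state[OF y]) (rule scale[OF state_carrier])
  then have g_z: "\<omega> * ?g z = ?g y * ?g x" by (simp add: shift[OF state_carrier])
  then have "cmod (\<omega> * ?g z) = cmod (?g y * ?g x)" by simp
  then have "cmod (?g z) = cmod (?g x)" using z(2) g_y by (simp add: norm_mult)
  then have "\<omega> * mtrace (mean \<rho> * W z) = ?g y * mtrace (mean \<rho> * W x)"
    using g_z by (simp add: mtrace_mean x z(1))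
  then show "mtrace (mean \<rho> * W y * W x) = mtrace (?g y \<cdot>\<^sub>m mean \<rho> * W x)"
    by (simp add: shift scale)
qed

lemma mtrace_mean_eq_1: "mtrace (mean \<rho>) = 1"
proof -
  obtain x where x: "x \<in> X" "W x = 1\<^sub>m N" using one_closed by blast
  then show ?thesis
    using mtrace_mean[OF x(1), of \<rho>] state_carrier trace mean_carrier[of \<rho>] by simp
qed

theorem majorized_mean: "majorized (spec_vec (mean \<rho>)) (spec_vec \<rho>)"
  using mult_mean[OF mean_carrier stabilizer_mean] mult_mean[OF state_carrier stabilizer_state]
    mtrace_mean_eq_1 psd_mat_prob_vec_spec_vec[OF psd trace]
  by (intro majorized_spec_vec_quasi_idempotent[OF mean_carrier state_carrier]) auto

end

end

section \<open>Tensor powers\<close>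

lemma digit_less: "0 < d \<Longrightarrow> digit d a k < d"
  by (simp add: digit_def)

lemma sum_digits: "(\<Sum>k<n. digit d a k * d ^ k) = a mod d ^ n"
proof (induction n)
  case (Suc n)
  have "a mod d ^ Suc n = d ^ n * (a div d ^ n mod d) + a mod d ^ n"
    using mod_mult2_eq[of a "d ^ n" d] by (simp add: mult.commute)
  then show ?case using Suc.IH by (simp add: digit_def mult.commute)
qed simp

lemma digit_eq_iff:
  assumes "a < d ^ n" "b < d ^ n"
  shows "(\<forall>k<n. digit d a k = digit d b k) \<longleftrightarrow> a = b"
proof
  assume "\<forall>k<n. digit d a k = digit d b k"
  then have "a mod d ^ n = b mod d ^ n" by (simp flip: sum_digits)
  then show "a = b" using assms by simp
qed simp

lemma bij_betw_digits:
  assumes "0 < d"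
  shows "bij_betw (\<lambda>a. \<lambda>k\<in>{..<n}. digit d a k) {..<d ^ n} ({..<n} \<rightarrow>\<^sub>E {..<d})"
    (is "bij_betw ?digits ?A ?B")
proof -
  have inj: "inj_on ?digits ?A"
  proof (rule inj_onI)
    fix a b assume ab: "a \<in> ?A" "b \<in> ?A" and "?digits a = ?digits b"
    then have "\<forall>k<n. digit d a k = digit d b k" by (metis lessThan_iff restrict_apply')
    then show "a = b" using ab digit_eq_iff by simp
  qed
  moreover have "?digits ` ?A = ?B"
  proof (rule card_subset_eq)
    show "?digits ` ?A \<subseteq> ?B"
      using assms by (simp add: image_subset_iff restrict_PiE_iff digit_less)
    show "card (?digits ` ?A) = card ?B" by (simp add: card_image[OF inj] card_PiE)
  qed (simp add: finite_PiE)
  ultimately show ?thesis by (simp add: bij_betw_def)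
qed

lemma sum_prod_digits:
  fixes F :: "nat \<Rightarrow> nat \<Rightarrow> 'a :: comm_semiring_1"
  assumes "0 < d"
  shows "(\<Sum>a<d ^ n. \<Prod>k<n. F k (digit d a k)) = (\<Prod>k<n. \<Sum>j<d. F k j)"
proof -
  have "(\<Prod>k<n. \<Sum>j<d. F k j) = (\<Sum>x\<in>{..<n} \<rightarrow>\<^sub>E {..<d}. \<Prod>k<n. F k (x k))"
    by (rule prod_sum_PiE) auto
  also have "\<dots> = (\<Sum>a<d ^ n. \<Prod>k<n. F k ((\<lambda>k\<in>{..<n}. digit d a k) k))"
    by (rule sum.reindex_bij_betw[OF bij_betw_digits[OF assms], symmetric])
  finally show ?thesis by simp
qed

lemma prod_of_bool:
  "finite A \<Longrightarrow> (\<Prod>k\<in>A. of_bool (P k) :: 'a :: comm_semiring_1) = of_bool (\<forall>k\<in>A. P k)"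
  by (induction A rule: finite_induct) auto

definition tensor_mat :: "nat \<Rightarrow> nat \<Rightarrow> (nat \<Rightarrow> 'a :: comm_semiring_1 mat) \<Rightarrow> 'a mat" where
  "tensor_mat d n F = mat (d ^ n) (d ^ n) (\<lambda>(a, b). \<Prod>k<n. F k $$ (digit d a k, digit d b k))"

lemma tensor_mat_carrier [simp]: "tensor_mat d n F \<in> carrier_mat (d ^ n) (d ^ n)"
  and dim_tensor_mat [simp]: "dim_row (tensor_mat d n F) = d ^ n"
    "dim_col (tensor_mat d n F) = d ^ n"
  and index_tensor_mat [simp]: "\<lbrakk>a < d ^ n; b < d ^ n\<rbrakk> \<Longrightarrow>
    tensor_mat d n F $$ (a, b) = (\<Prod>k<n. F k $$ (digit d a k, digit d b k))"
  by (simp_all add: tensor_mat_def)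

lemma tensor_mat_cong: "(\<And>k. k < n \<Longrightarrow> F k = G k) \<Longrightarrow> tensor_mat d n F = tensor_mat d n G"
  by (intro eq_matI) simp_all

context
  fixes d :: nat
  assumes d: "0 < d"
begin

lemma tensor_mat_one: "tensor_mat d n (\<lambda>_. 1\<^sub>m d) = 1\<^sub>m (d ^ n)"
proof (rule eq_matI)
  fix a b assume "a < dim_row (1\<^sub>m (d ^ n) :: 'a mat)" "b < dim_col (1\<^sub>m (d ^ n) :: 'a mat)"
  then have ab: "a < d ^ n" "b < d ^ n" by simp_all
  then have "tensor_mat d n (\<lambda>_. 1\<^sub>m d) $$ (a, b) =
      (\<Prod>k<n. of_bool (digit d a k = digit d b k) :: 'a)"
    using d by (auto simp: digit_less intro!: prod.cong)
  then show "tensor_mat d n (\<lambda>_. 1\<^sub>m d) $$ (a, b) = (1\<^sub>m (d ^ n) :: 'a mat) $$ (a, b)"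
    using ab by (simp add: prod_of_bool digit_eq_iff Ball_def)
qed simp_all

lemma tensor_mat_mult:
  assumes F: "\<And>k. k < n \<Longrightarrow> F k \<in> carrier_mat d d" and G: "\<And>k. k < n \<Longrightarrow> G k \<in> carrier_mat d d"
  shows "tensor_mat d n F * tensor_mat d n G = tensor_mat d n (\<lambda>k. F k * G k)"
proof (rule eq_matI)
  let ?FG = "tensor_mat d n (\<lambda>k. F k * G k)"
  fix a b assume "a < dim_row ?FG" "b < dim_col ?FG"
  then have ab: "a < d ^ n" "b < d ^ n" by simp_all
  then have "(tensor_mat d n F * tensor_mat d n G) $$ (a, b) =
      (\<Sum>c<d ^ n. \<Prod>k<n. F k $$ (digit d a k, digit d c k) * G k $$ (digit d c k, digit d b k))"
    by (simp add: scalar_prod_def atLeast0LessThan prod.distrib)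
  also have "\<dots> = (\<Prod>k<n. \<Sum>l<d. F k $$ (digit d a k, l) * G k $$ (l, digit d b k))"
    by (rule sum_prod_digits[OF d])
  also have "\<dots> = (\<Prod>k<n. (F k * G k) $$ (digit d a k, digit d b k))"
  proof (rule prod.cong[OF refl])
    fix k assume "k \<in> {..<n}"
    then have "F k \<in> carrier_mat d d" "G k \<in> carrier_mat d d" using F G by simp_all
    then show "(\<Sum>l<d. F k $$ (digit d a k, l) * G k $$ (l, digit d b k)) =
        (F k * G k) $$ (digit d a k, digit d b k)"
      using d by (simp add: scalar_prod_def atLeast0LessThan digit_less)
  qed
  finally show "(tensor_mat d n F * tensor_mat d n G) $$ (a, b) = ?FG $$ (a, b)"
    using ab by simp
qed simp_all

lemma tensor_mat_smult:
  assumes "\<And>k. k < n \<Longrightarrow> F k \<in> carrier_mat d d"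
  shows "tensor_mat d n (\<lambda>k. c k \<cdot>\<^sub>m F k) = (\<Prod>k<n. c k) \<cdot>\<^sub>m tensor_mat d n F"
  using d carrier_matD[OF assms]
  by (intro eq_matI) (simp_all add: digit_less prod.distrib)

lemma mat_adjoint_tensor_mat:
  fixes F :: "nat \<Rightarrow> complex mat"
  assumes "\<And>k. k < n \<Longrightarrow> F k \<in> carrier_mat d d"
  shows "mat_adjoint (tensor_mat d n F) = tensor_mat d n (\<lambda>k. mat_adjoint (F k))"
  using d carrier_matD[OF assms]
  by (intro eq_matI) (simp_all add: digit_less)

end

context nice_error_basis
begin

abbreviation tensor_W :: "nat \<Rightarrow> (nat \<Rightarrow> 'x) \<Rightarrow> complex mat" where
  "tensor_W n x \<equiv> tensor_mat N n (\<lambda>k. W (x k))"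

lemma PiE_W_carrier: "x \<in> {..<n} \<rightarrow>\<^sub>E X \<Longrightarrow> k < n \<Longrightarrow> W (x k) \<in> carrier_mat N N"
  by (intro W_carrier) auto

lemma tensor_W_unitary:
  assumes x: "x \<in> {..<n} \<rightarrow>\<^sub>E X"
  shows "tensor_W n x * mat_adjoint (tensor_W n x) = 1\<^sub>m (N ^ n)"
proof -
  have "tensor_W n x * mat_adjoint (tensor_W n x) =
      tensor_mat N n (\<lambda>k. W (x k) * mat_adjoint (W (x k)))"
    using PiE_W_carrier[OF x] by (simp add: mat_adjoint_tensor_mat tensor_mat_mult N_pos)
  also have "\<dots> = tensor_mat N n (\<lambda>_. 1\<^sub>m N)"
    using x by (intro tensor_mat_cong unitary) auto
  finally show ?thesis by (simp add: tensor_mat_one N_pos)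
qed

lemma tensor_W_complete:
  assumes less: "a < N ^ n" "b < N ^ n" "i < N ^ n" "j < N ^ n"
  shows "(\<Sum>x\<in>{..<n} \<rightarrow>\<^sub>E X. tensor_W n x $$ (a, b) * cnj (tensor_W n x $$ (i, j))) =
    of_nat (N ^ n) * of_bool (a = i \<and> b = j)"
proof -
  let ?a = "digit N a" and ?b = "digit N b" and ?i = "digit N i" and ?j = "digit N j"
  have "(\<Sum>x\<in>{..<n} \<rightarrow>\<^sub>E X. tensor_W n x $$ (a, b) * cnj (tensor_W n x $$ (i, j))) =
      (\<Sum>x\<in>{..<n} \<rightarrow>\<^sub>E X. \<Prod>k<n. W (x k) $$ (?a k, ?b k) * cnj (W (x k) $$ (?i k, ?j k)))"
    using less by (simp add: prod.distrib)
  also have "\<dots> = (\<Prod>k<n. \<Sum>y\<in>X. W y $$ (?a k, ?b k) * cnj (W y $$ (?i k, ?j k)))"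
    using finite_X by (intro prod_sum_PiE[symmetric]) auto
  also have "\<dots> = (\<Prod>k<n. of_nat N * of_bool (?a k = ?i k \<and> ?b k = ?j k))"
    using N_pos by (simp add: complete digit_less)
  also have "\<dots> = of_nat (N ^ n) * of_bool (\<forall>k<n. ?a k = ?i k \<and> ?b k = ?j k)"
    by (simp add: prod.distrib prod_of_bool Ball_def del: of_bool_conj)
  also have "(\<forall>k<n. ?a k = ?i k \<and> ?b k = ?j k) \<longleftrightarrow> a = i \<and> b = j"
    using less digit_eq_iff[of a N n i] digit_eq_iff[of b N n j] by auto
  finally show ?thesis .
qed

lemma tensor_W_mult_closed:
  assumes x: "x \<in> {..<n} \<rightarrow>\<^sub>E X" and y: "y \<in> {..<n} \<rightarrow>\<^sub>E X"
  shows "\<exists>z\<in>{..<n} \<rightarrow>\<^sub>E X. \<exists>\<omega>. cmod \<omega> = 1 \<and> tensor_W n x * tensor_W n y = \<omega> \<cdot>\<^sub>m tensor_W n z"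
proof -
  have "\<exists>z \<omega>. k < n \<longrightarrow> z \<in> X \<and> cmod \<omega> = 1 \<and> W (x k) * W (y k) = \<omega> \<cdot>\<^sub>m W z" for k
    using mult_closed[of "x k" "y k"] x y by blast
  then obtain z \<omega> where z: "k < n \<Longrightarrow> z k \<in> X" and \<omega>: "k < n \<Longrightarrow> cmod (\<omega> k) = 1"
    and mult: "k < n \<Longrightarrow> W (x k) * W (y k) = \<omega> k \<cdot>\<^sub>m W (z k)" for k
    by metis
  let ?z = "restrict z {..<n}"
  have z_mem: "?z \<in> {..<n} \<rightarrow>\<^sub>E X" using z by auto
  have "tensor_W n x * tensor_W n y = tensor_mat N n (\<lambda>k. W (x k) * W (y k))"
    using PiE_W_carrier x y by (intro tensor_mat_mult[OF N_pos])
  also have "\<dots> = tensor_mat N n (\<lambda>k. \<omega> k \<cdot>\<^sub>m W (?z k))"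
    by (intro tensor_mat_cong) (simp add: mult)
  also have "\<dots> = (\<Prod>k<n. \<omega> k) \<cdot>\<^sub>m tensor_W n ?z"
    by (rule tensor_mat_smult[OF N_pos PiE_W_carrier[OF z_mem]])
  finally have "tensor_W n x * tensor_W n y = (\<Prod>k<n. \<omega> k) \<cdot>\<^sub>m tensor_W n ?z" .
  moreover have "cmod (\<Prod>k<n. \<omega> k) = 1" using \<omega> by (simp flip: prod_norm)
  ultimately show ?thesis using z_mem by blast
qed

lemma tensor_W_one_closed: "\<exists>x\<in>{..<n} \<rightarrow>\<^sub>E X. tensor_W n x = 1\<^sub>m (N ^ n)"
proof -
  obtain e where e: "e \<in> X" "W e = 1\<^sub>m N" using one_closed by blast
  have "tensor_W n (\<lambda>k\<in>{..<n}. e) = tensor_mat N n (\<lambda>_. 1\<^sub>m N)"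
    by (intro tensor_mat_cong) (simp add: e)
  then show ?thesis
    using e(1) by (intro bexI[of _ "\<lambda>k\<in>{..<n}. e"]) (auto simp: tensor_mat_one N_pos)
qed

theorem nice_error_basis_tensor_W: "nice_error_basis (N ^ n) ({..<n} \<rightarrow>\<^sub>E X) (tensor_W n)"
proof
  show "finite ({..<n} \<rightarrow>\<^sub>E X)" by (simp add: finite_X finite_PiE)
  show "0 < N ^ n" by (simp add: N_pos)
qed (rule tensor_mat_carrier tensor_W_unitary tensor_W_complete tensor_W_mult_closed
    tensor_W_one_closed; assumption)+

end

section \<open>Weyl operators\<close>

lemma chi_add: "chi d (x + y) = chi d x * chi d y"
  by (simp add: chi_def exp_add[symmetric] add_divide_distrib algebra_simps)

lemma chi_0 [simp]: "chi d 0 = 1"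
  by (simp add: chi_def)

lemma chi_eq_cis: "chi d x = cis (2 * pi * of_int x / of_nat d)"
  by (simp add: chi_def cis_conv_exp mult_ac)

lemma cmod_chi [simp]: "cmod (chi d x) = 1"
  by (simp add: chi_eq_cis)

lemma cnj_chi: "cnj (chi d x) = chi d (- x)"
  by (simp add: chi_eq_cis cis_cnj)

lemma chi_mult_nat: "chi d (int k * x) = chi d x ^ k"
  by (induction k) (simp_all add: chi_add algebra_simps)

lemma cmod_weyl_phase [simp]: "cmod (weyl_phase d p q) = 1"
  by (simp add: weyl_phase_def norm_power)

context
  fixes d :: nat
  assumes d: "0 < d"
begin

lemma chi_eq_1_iff: "chi d x = 1 \<longleftrightarrow> int d dvd x"
proof -
  have "chi d x = 1 \<longleftrightarrow> cos (2 * pi * of_int x / of_nat d) = 1"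
    by (auto simp: chi_eq_cis complex_eq_iff cos_one_sin_zero)
  also have "\<dots> \<longleftrightarrow> (\<exists>n::int. 2 * pi * of_int x / of_nat d = of_int n * 2 * pi)"
    by (rule cos_one_2pi_int)
  also have "\<dots> \<longleftrightarrow> (\<exists>n::int. real_of_int x = of_int (int d * n))"
    using d by (simp add: field_simps)
  finally show ?thesis by (simp only: of_int_eq_iff dvd_def)
qed

lemma chi_cong:
  assumes "[x = y] (mod int d)"
  shows "chi d x = chi d y"
proof -
  have "chi d (x - y) = 1" using assms by (simp add: chi_eq_1_iff cong_iff_dvd_diff)
  then show ?thesis using chi_add[of d "x - y" y] by simp
qed

lemma sum_chi: "(\<Sum>p\<in>{0..<int d}. chi d (p * x)) = of_nat d * of_bool (int d dvd x)"
proof -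
  have "(\<Sum>p\<in>{0..<int d}. chi d (p * x)) = (\<Sum>k<d. chi d x ^ k)"
    by (simp add: image_int_atLeastLessThan[symmetric, of 0, simplified] sum.reindex chi_mult_nat
        atLeast0LessThan)
  moreover have "chi d x ^ d = 1"
    using chi_eq_1_iff[of "int d * x"] by (simp add: chi_mult_nat)
  ultimately show ?thesis
    using chi_eq_1_iff[of x] by (cases "int d dvd x") (simp_all add: geometric_sum)
qed

lemma cong_int_less_iff: "a < d \<Longrightarrow> b < d \<Longrightarrow> [int a = int b] (mod int d) \<longleftrightarrow> a = b"
  by (simp add: cong_int_iff cong_less_imp_eq_nat) (simp add: cong_def)

definition weyl_coeff :: "int \<Rightarrow> int \<Rightarrow> nat \<Rightarrow> complex" where
  "weyl_coeff p q j = weyl_phase d (p mod int d) (q mod int d) * chi d (p * int j)"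

lemma weyl1_eq:
  "weyl1 d p q j l = (if [int j = int l + q] (mod int d) then weyl_coeff p q j else 0)"
  by (simp add: weyl1_def weyl_coeff_def cong_def)

lemma weyl_coeff_mult_cnj:
  "weyl_coeff p q i * cnj (weyl_coeff p q j) = chi d (p * (int i - int j))"
proof -
  let ?w = "weyl_phase d (p mod int d) (q mod int d)"
  have "weyl_coeff p q i * cnj (weyl_coeff p q j) =
      (?w * cnj ?w) * (chi d (p * int i) * cnj (chi d (p * int j)))"
    by (simp add: weyl_coeff_def)
  also have "?w * cnj ?w = 1" by (simp add: complex_norm_square[symmetric])
  finally show ?thesis by (simp add: cnj_chi chi_add[symmetric] right_diff_distrib)
qed

lemma weyl_coeff_mult:
  obtains \<omega> where "cmod \<omega> = 1" and "\<And>i m. [int i = int m + q] (mod int d) \<Longrightarrow>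
    weyl_coeff p q i * weyl_coeff p' q' m = \<omega> * weyl_coeff (p + p') (q + q') i"
proof
  let ?w = "\<lambda>p q. weyl_phase d (p mod int d) (q mod int d)"
  let ?\<omega> = "?w p q * ?w p' q' * chi d (- (p' * q)) / ?w (p + p') (q + q')"
  show "cmod ?\<omega> = 1" by (simp add: norm_mult norm_divide)
  have "?w (p + p') (q + q') \<noteq> 0" using cmod_weyl_phase by (metis norm_zero zero_neq_one)
  moreover fix i m assume "[int i = int m + q] (mod int d)"
  then have "[int m = int i - q] (mod int d)"
    using cong_diff[OF _ cong_refl[of q]] by (fastforce simp: cong_sym_eq)
  then have "chi d (p' * int m) = chi d (p' * (int i - q))"
    by (intro chi_cong cong_mult cong_refl)
  then have "chi d (p * int i) * chi d (p' * int m) = chi d (- (p' * q)) * chi d ((p + p') * int i)"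
    by (simp add: chi_add[symmetric] algebra_simps)
  ultimately show "weyl_coeff p q i * weyl_coeff p' q' m = ?\<omega> * weyl_coeff (p + p') (q + q') i"
    by (simp add: weyl_coeff_def)
qed

lemma sum_weyl1_mult:
  obtains m where "m < d" "[int j = int m + q] (mod int d)"
    "(\<Sum>l<d. weyl1 d p q j l * f l) = weyl_coeff p q j * f m"
proof
  define m where "m = nat ((int j - q) mod int d)"
  have int_m: "int m = (int j - q) mod int d" using d by (simp add: m_def)
  show m: "m < d" using d by (simp add: m_def nat_less_iff)
  show m_cong: "[int j = int m + q] (mod int d)" by (simp add: int_m cong_def mod_add_left_eq)
  have "[int j = int l + q] (mod int d) \<longleftrightarrow> l = m" if "l < d" for l
    using cong_int_less_iff[OF that m] m_cong by (metis cong_add_rcancel cong_sym cong_trans)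
  then have "(\<Sum>l<d. weyl1 d p q j l * f l) = (\<Sum>l<d. if l = m then weyl_coeff p q j * f m else 0)"
    by (intro sum.cong refl) (simp add: weyl1_eq)
  then show "(\<Sum>l<d. weyl1 d p q j l * f l) = weyl_coeff p q j * f m"
    using m by simp
qed

definition weyl1_mat :: "int \<Rightarrow> int \<Rightarrow> complex mat" where
  "weyl1_mat p q = mat d d (\<lambda>(j, l). weyl1 d p q j l)"

lemma weyl1_mat_carrier [simp]: "weyl1_mat p q \<in> carrier_mat d d"
  and dim_weyl1_mat [simp]: "dim_row (weyl1_mat p q) = d" "dim_col (weyl1_mat p q) = d"
  and index_weyl1_mat [simp]: "\<lbrakk>j < d; l < d\<rbrakk> \<Longrightarrow> weyl1_mat p q $$ (j, l) = weyl1 d p q j l"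
  by (simp_all add: weyl1_mat_def)

lemma weyl1_mat_unitary: "weyl1_mat p q * mat_adjoint (weyl1_mat p q) = 1\<^sub>m d"
proof (rule eq_matI)
  fix i j assume "i < dim_row (1\<^sub>m d :: complex mat)" "j < dim_col (1\<^sub>m d :: complex mat)"
  then have ij: "i < d" "j < d" by simp_all
  obtain m where "[int i = int m + q] (mod int d)"
    and sum: "(\<Sum>l<d. weyl1 d p q i l * cnj (weyl1 d p q j l)) =
      weyl_coeff p q i * cnj (weyl1 d p q j m)"
    by (rule sum_weyl1_mult)
  then have "[int j = int m + q] (mod int d) \<longleftrightarrow> i = j"
    using cong_int_less_iff[OF ij] by (meson cong_sym cong_trans)
  then have "(\<Sum>l<d. weyl1 d p q i l * cnj (weyl1 d p q j l)) = of_bool (i = j)"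
    unfolding sum by (simp add: weyl1_eq weyl_coeff_mult_cnj)
  then show "(weyl1_mat p q * mat_adjoint (weyl1_mat p q)) $$ (i, j) = 1\<^sub>m d $$ (i, j)"
    using ij by (simp add: scalar_prod_def atLeast0LessThan)
qed simp_all

lemma weyl1_mat_mult:
  obtains \<omega> where "cmod \<omega> = 1"
    "weyl1_mat p q * weyl1_mat p' q' = \<omega> \<cdot>\<^sub>m weyl1_mat (p + p') (q + q')"
proof -
  obtain \<omega> where \<omega>: "cmod \<omega> = 1" and coeff: "\<And>i m. [int i = int m + q] (mod int d) \<Longrightarrow>
      weyl_coeff p q i * weyl_coeff p' q' m = \<omega> * weyl_coeff (p + p') (q + q') i"
    by (rule weyl_coeff_mult[where p = p and q = q and p' = p' and q' = q']) blast
  have "weyl1_mat p q * weyl1_mat p' q' = \<omega> \<cdot>\<^sub>m weyl1_mat (p + p') (q + q')" (is "?A = ?B")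
  proof (rule eq_matI)
    fix i j assume "i < dim_row ?B" "j < dim_col ?B"
    then have ij: "i < d" "j < d" by simp_all
    obtain m where m: "[int i = int m + q] (mod int d)"
      and sum: "(\<Sum>l<d. weyl1 d p q i l * weyl1 d p' q' l j) = weyl_coeff p q i * weyl1 d p' q' m j"
      by (rule sum_weyl1_mult)
    have "[int m = int j + q'] (mod int d) \<longleftrightarrow> [int m + q = int j + (q + q')] (mod int d)"
      using cong_add_rcancel[of "int m" q "int j + q'" "int d"] by (simp add: ac_simps)
    then have "[int m = int j + q'] (mod int d) \<longleftrightarrow> [int i = int j + (q + q')] (mod int d)"
      using m by (meson cong_sym cong_trans)
    then have "(\<Sum>l<d. weyl1 d p q i l * weyl1 d p' q' l j) = \<omega> * weyl1 d (p + p') (q + q') i j"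
      unfolding sum by (simp add: weyl1_eq coeff[OF m])
    then show "?A $$ (i, j) = ?B $$ (i, j)"
      using ij by (simp add: scalar_prod_def atLeast0LessThan)
  qed simp_all
  then show thesis using \<omega> that by blast
qed

lemma weyl1_mat_0: "weyl1_mat 0 0 = 1\<^sub>m d"
  by (intro eq_matI) (simp_all add: weyl1_eq weyl_coeff_def cong_int_less_iff weyl_phase_def)

lemma weyl1_mat_mod: "weyl1_mat (p mod int d) (q mod int d) = weyl1_mat p q"
proof -
  have "weyl1 d (p mod int d) (q mod int d) j l = weyl1 d p q j l" for j l
  proof -
    have "chi d (p mod int d * int j) = chi d (p * int j)"
      by (intro chi_cong) (simp add: cong_def mod_mult_left_eq)
    then show ?thesis by (simp add: weyl1_def mod_add_right_eq)
  qed
  then show ?thesis by (intro eq_matI) simp_all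
qed

lemma weyl1_complete:
  assumes less: "a < d" "b < d" "i < d" "j < d"
  shows "(\<Sum>(p, q)\<in>{0..<int d} \<times> {0..<int d}. weyl1 d p q a b * cnj (weyl1 d p q i j)) =
    of_nat d * of_bool (a = i \<and> b = j)"
proof -
  let ?D = "{0..<int d}"
  define r where "r = (int a - int b) mod int d"
  have r: "r \<in> ?D" using d by (simp add: r_def)
  have q_iff: "[int a = int b + q] (mod int d) \<longleftrightarrow> q = r" if "q \<in> ?D" for q
  proof -
    have "[int a = int b + q] (mod int d) \<longleftrightarrow> [int a - int b = q] (mod int d)"
      by (simp add: cong_iff_dvd_diff diff_diff_eq)
    then show ?thesis using that by (auto simp: cong_def r_def)
  qed
  have r_iff: "[int i = int j + r] (mod int d) \<longleftrightarrow> b = j" if "a = i"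
  proof -
    have "[int i = int j + r] (mod int d) \<longleftrightarrow> [int i - int j = int a - int b] (mod int d)"
      by (simp add: cong_def r_def mod_add_right_eq mod_eq_dvd_iff algebra_simps)
    also have "\<dots> \<longleftrightarrow> [int b = int j] (mod int d)"
      by (simp add: that cong_iff_dvd_diff)
    finally show ?thesis using cong_int_less_iff[OF less(2,4)] by simp
  qed
  have "(\<Sum>(p, q)\<in>?D \<times> ?D. weyl1 d p q a b * cnj (weyl1 d p q i j)) =
      (\<Sum>p\<in>?D. \<Sum>q\<in>?D. if q = r then
        of_bool [int i = int j + r] (mod int d) * chi d (p * (int a - int i)) else 0)"
    unfolding sum.cartesian_product[symmetric]
    by (intro sum.cong refl) (simp add: weyl1_eq q_iff weyl_coeff_mult_cnj)
  also have "\<dots> = of_bool [int i = int j + r] (mod int d) * (of_nat d * of_bool (a = i))"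
    using r cong_int_less_iff[OF less(1,3)]
    by (simp add: sum_chi sum_distrib_left[symmetric] cong_iff_dvd_diff)
  also have "\<dots> = of_nat d * of_bool (a = i \<and> b = j)" using r_iff by auto
  finally show ?thesis .
qed

lemma nice_error_basis_weyl1:
  "nice_error_basis d ({0..<int d} \<times> {0..<int d}) (\<lambda>(p, q). weyl1_mat p q)"
proof
  let ?D = "{0..<int d}" and ?W = "\<lambda>(p, q). weyl1_mat p q"
  show "finite (?D \<times> ?D)" "0 < d" using d by simp_all
  show "?W x \<in> carrier_mat d d" "?W x * mat_adjoint (?W x) = 1\<^sub>m d" for x
    by (simp_all add: weyl1_mat_unitary split: prod.split)
  show "(\<Sum>x\<in>?D \<times> ?D. ?W x $$ (a, b) * cnj (?W x $$ (i, j))) = of_nat d * of_bool (a = i \<and> b = j)"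
    if "a < d" "b < d" "i < d" "j < d" for a b i j
    using weyl1_complete[OF that] that by (simp add: case_prod_beta)
  show "\<exists>z\<in>?D \<times> ?D. \<exists>\<omega>. cmod \<omega> = 1 \<and> ?W x * ?W y = \<omega> \<cdot>\<^sub>m ?W z" for x y
  proof -
    obtain p q p' q' where xy: "x = (p, q)" "y = (p', q')" by fastforce
    obtain \<omega> where "cmod \<omega> = 1"
      "weyl1_mat p q * weyl1_mat p' q' = \<omega> \<cdot>\<^sub>m weyl1_mat (p + p') (q + q')"
      by (rule weyl1_mat_mult)
    then show ?thesis
      using d by (intro bexI[of _ "((p + p') mod int d, (q + q') mod int d)"] exI[of _ \<omega>])
        (simp_all add: xy weyl1_mat_mod)
  qed
  show "\<exists>x\<in>?D \<times> ?D. ?W x = 1\<^sub>m d"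
    using d weyl1_mat_0 by (intro bexI[of _ "(0, 0)"]) simp_all
qed

lemma weyl_eq_tensor_mat: "weyl d n p q = tensor_mat d n (\<lambda>k. weyl1_mat (p k) (q k))"
  using d by (intro eq_matI) (simp_all add: weyl_def digit_less)

definition phase_space :: "nat \<Rightarrow> (nat \<Rightarrow> int \<times> int) set" where
  "phase_space n = ({..<n} \<rightarrow>\<^sub>E {0..<int d} \<times> {0..<int d})"

definition weyl_at :: "nat \<Rightarrow> (nat \<Rightarrow> int \<times> int) \<Rightarrow> complex mat" where
  "weyl_at n x = weyl d n (fst \<circ> x) (snd \<circ> x)"

lemma nice_error_basis_weyl: "nice_error_basis (d ^ n) (phase_space n) (weyl_at n)"
  using nice_error_basis.nice_error_basis_tensor_W[OF nice_error_basis_weyl1, of n]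
  by (simp add: phase_space_def weyl_at_def[abs_def] weyl_eq_tensor_mat case_prod_beta)

lemma weyl_in_phase_space:
  obtains x where "x \<in> phase_space n" "weyl d n p q = weyl_at n x"
proof
  let ?x = "\<lambda>k\<in>{..<n}. (p k mod int d, q k mod int d)"
  show "?x \<in> phase_space n" using d by (auto simp: phase_space_def)
  show "weyl d n p q = weyl_at n ?x"
    unfolding weyl_at_def weyl_eq_tensor_mat by (intro tensor_mat_cong) (simp add: weyl1_mat_mod)
qed

lemma mean_state_eq_mean:
  "mean_state d n \<rho> = nice_error_basis.mean (d ^ n) (phase_space n) (weyl_at n) \<rho>"
proof -
  interpret nice_error_basis "d ^ n" "phase_space n" "weyl_at n" by (rule nice_error_basis_weyl)
  show ?thesis
    unfolding mean_state_def
  proof (rule the_equality; (intro conjI allI)?; (elim conjE)?)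
    show "mean \<rho> \<in> carrier_mat (d ^ n) (d ^ n)" by simp
    show "char_fun d n (mean \<rho>) p q =
        (if cmod (char_fun d n \<rho> p q) = 1 then char_fun d n \<rho> p q else 0)" for p q
    proof -
      obtain x where "x \<in> phase_space n" "weyl d n (\<lambda>k. - p k) (\<lambda>k. - q k) = weyl_at n x"
        by (rule weyl_in_phase_space)
      then show ?thesis by (simp only: char_fun_def mtrace_mean)
    qed
    fix M assume M: "M \<in> carrier_mat (d ^ n) (d ^ n)" and char_fun_M: "\<forall>p q. char_fun d n M p q =
        (if cmod (char_fun d n \<rho> p q) = 1 then char_fun d n \<rho> p q else 0)"
    show "M = mean \<rho>"
    proof (rule eq_by_mtrace[OF M mean_carrier])
      fix x assume x: "x \<in> phase_space n"
      have "char_fun d n A (\<lambda>k. - fst (x k)) (\<lambda>k. - snd (x k)) = mtrace (A * weyl_at n x)" for A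
        by (simp add: char_fun_def weyl_at_def comp_def)
      then show "mtrace (M * weyl_at n x) = mtrace (mean \<rho> * weyl_at n x)"
        using char_fun_M unfolding mtrace_mean[OF x] by metis
    qed
  qed
qed

end

theorem mainTheorem3:
  fixes d n :: nat and \<rho> :: "complex mat"
  assumes "prime d" and "n \<ge> 1" and "is_state d n \<rho>"
  shows "majorized (spec_vec (mean_state d n \<rho>)) (spec_vec \<rho>) \<and>
         (\<forall>f. schur_concave (d ^ n) f \<longrightarrow> f (spec_vec \<rho>) \<le> f (spec_vec (mean_state d n \<rho>)))"
proof -
  have d: "0 < d" using assms(1) by (rule prime_gt_0_nat)
  note \<rho> = is_state_imp_psd_mat[OF assms(3)]
  have "majorized (spec_vec (mean_state d n \<rho>)) (spec_vec \<rho>)"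
    unfolding mean_state_eq_mean[OF d]
    by (rule nice_error_basis.majorized_mean[OF nice_error_basis_weyl[OF d] \<rho>])
  moreover have "length (spec_vec \<rho>) = d ^ n"
    by (rule length_spec_vec[OF psd_mat_carrier[OF \<rho>(1)]])
  ultimately show ?thesis by (auto simp: schur_concave_def majorized_def)
qed

end
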